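(* Let $P(\alpha,\beta)=\sum_{i=0}^k\alpha^i\beta^{k-i}B_i\in\mathbb{C}[\alpha,\beta]_k^{n\times n}$ be a regular homogeneous matrix polynomial, let $A=\begin{bmatrix}a&b\\c&d\end{bmatrix}\in GL(2,\mathbb{C})$, and let $M_A(P)(\gamma,\delta)=\sum_{i=0}^k\gamma^i\delta^{k-i}\widetilde B_i$ be the Möbius transform of $P$ under $M_A$. Let $(\widehat x,(\widehat{\gamma_0},\widehat{\delta_0}))$ and $(\widehat y^*,(\widehat{\gamma_0},\widehat{\delta_0}))$ be approximate right and left eigenpairs of $M_A(P)$. For $s=a,p,r$ let $$Q_{\eta,\mathrm{right}}^{s}:=\frac{\eta_P^s(\widehat x,\langle A[\widehat{\gamma_0},\widehat{\delta_0}]^T\rangle)}{\eta_{M_A(P)}^s(\widehat x,(\widehat{\gamma_0},\widehat{\delta_0}))},\qquad Q_{\eta,\mathrm{left}}^{s}:=\frac{\eta_P^s(\widehat y^*,\langle A[\widehat{\gamma_0},\widehat{\delta_0}]^T\rangle)}{\eta_{M_A(P)}^s(\widehat y^*,(\widehat{\gamma_0},\widehat{\delta_0}))},$$ and let $Y_k:=(k+1)^2\binom{k}{\lfloor k/2\rfloor}$. Then: 1. $\displaystyle\frac{1}{(k+1)\|A\|_\infty^k}\le Q_{\eta,\mathrm{right}}^{a}=Q_{\eta,\mathrm{left}}^{a}\le(k+1)\|A^{-1}\|_\infty^k$. 2. $\displaystyle\frac{1}{Y_k\,\mathrm{cond}_\infty(A)^k}\le Q_{\eta,\mathrm{right}}^{p}=Q_{\eta,\mathrm{left}}^{p}\le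 Y_k\,\mathrm{cond}_\infty(A)^k$. 3. If $B_0\neq0$, $B_k\ne0$, $\widetilde B_0\ne0$ and $\widetilde B_k\ne0$, and $$\rho:=\frac{\max_{i=0:k}\{\|B_i\|_2\}}{\min\{\|B_0\|_2,\|B_k\|_2\}},\qquad\widetilde\rho:=\frac{\max_{i=0:k}\{\|\widetilde B_i\|_2\}}{\min\{\|\widetilde B_0\|_2,\|\widetilde B_k\|_2\}},$$ then $$\frac{1}{Y_k\,\mathrm{cond}_\infty(A)^k\,\widetilde\rho}\le Q_{\eta,\mathrm{right}}^{r}=Q_{\eta,\mathrm{left}}^{r}\le Y_k\,\mathrm{cond}_\infty(A)^k\,\rho.$$
   Context: $\mathbb{C}[\alpha,\beta]_k^{n\times n}$ is the space of homogeneous matrix polynomials $P(\alpha,\beta)=\sum_{i=0}^k\alpha^i\beta^{k-i}B_i$ with $B_i\in\mathbb{C}^{n\times n}$ (including zero). $P$ is regular if $\det P(\alpha,\beta)\not\equiv0$. $GL(2,\mathbb{C})$ is the set of nonsingular $2\times2$ complex matrices. The Möbius transform of $P$ under $M_A$ is $M_A(P)(\gamma,\delta)=\sum_{i=0}^k(a\gamma+b\delta)^i(c\gamma+d\delta)^{k-i}B_i$. It is regular when $P$ is. Eigenvalues and approximate eigenvalues are lines $(\alpha_0,\beta_0)=\langle[\alpha_0,\beta_0]^T\rangle$ through the origin in $\mathbb{C}^2$ spanned by nonzero vectors (representatives); $\langle v\rangle$ is the line spanned by $v$. An approximate right (left) eigenpair consists of a nonzero vector $\widehat x\in\mathbb{C}^n$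 (resp. $\widehat y\in\mathbb{C}^n$) and a line $(\widehat{\alpha_0},\widehat{\beta_0})$. For nonnegative weights $\omega_i$, its backward error with respect to a regular $P$ is $$\eta_P(\widehat x,(\widehat{\alpha_0},\widehat{\beta_0}))=\min\{\epsilon:(P(\widehat{\alpha_0},\widehat{\beta_0})+\Delta P(\widehat{\alpha_0},\widehat{\beta_0}))\widehat x=0,\ \|\Delta B_i\|_2\le\epsilon\,\omega_i,\ i=0:k\},$$ $$\eta_P(\widehat y^*,(\widehat{\alpha_0},\widehat{\beta_0}))=\min\{\epsilon:\widehat y^*(P(\widehat{\alpha_0},\widehat{\beta_0})+\Delta P(\widehat{\alpha_0},\widehat{\beta_0}))=0,\ \|\Delta B_i\|_2\le\epsilon\,\omega_i,\ i=0:k\},$$ where $\Delta P(\alpha,\beta)=\sum_{i=0}^k\alpha^i\beta^{k-i}\Delta B_i$. Known explicit formulas: $\eta_P(\widehat x,\cdot)=\|P(\widehat{\alpha_0},\widehat{\beta_0})\widehat x\|_2/\big((\sum_i|\widehat{\alpha_0}|^i|\widehat{\beta_0}|^{k-i}\omega_i)\|\widehat x\|_2\big)$ and $\eta_P(\widehat y^*,\cdot)=\|\widehat y^*P(\widehat{\alpha_0},\widehat{\beta_0})\|_2/\big((\sum_i|\widehat{\alpha_0}|^i|\widehat{\beta_0}|^{k-i}\omega_i)\|\widehat y\|_2\big)$; these do not depend on the representative. The superscripts indicate the weights: $\eta_P^a$: $\omega_i=1$; $\eta_P^p$: $\omega_i=\max_{j=0:k}\|B_j\|_2$; $\eta_P^r$: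 $\omega_i=\|B_i\|_2$ (for all $i=0:k$). For $M_A(P)$ the same choices are made with $\widetilde B_i$ in place of $B_i$. The quotients are considered only when they are defined, i.e. when the backward errors in their denominators are nonzero. $\|\cdot\|_2$ is the Euclidean/spectral norm, $\|A\|_\infty$ the maximum absolute row sum, and $\mathrm{cond}_\infty(A)=\|A\|_\infty\|A^{-1}\|_\infty$. *)

theory Defs
  imports "HOL-Analysis.Analysis"
begin

definition smat :: "complex \<Rightarrow> complex^'n^'m \<Rightarrow> complex^'n^'m" where
  "smat c M = (\<chi> i j. c * M $ i $ j)"

text \<open>
  The library norm of a matrix is the Frobenius norm, so the spectral norm is
  taken as the operator norm with respect to the Euclidean norm of vectors.
\<close>

definition spec_norm :: "complex^'n^'m \<Rightarrow> real" where
  "spec_norm M = onorm ((*v) M)"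

definition inf_norm :: "complex^'n^'m \<Rightarrow> real" where
  "inf_norm M = Max (range (\<lambda>i. \<Sum>j\<in>UNIV. norm (M $ i $ j)))"

definition cond_inf :: "complex^'n^'n \<Rightarrow> real" where
  "cond_inf M = inf_norm M * inf_norm (matrix_inv M)"

definition conj_vec :: "complex^'n \<Rightarrow> complex^'n" where
  "conj_vec y = (\<chi> i. cnj (y $ i))"

text \<open>
  A homogeneous matrix polynomial of degree \<open>k\<close> is given by its coefficients
  \<open>B 0, \<dots>, B k\<close>; the values of \<open>B\<close> beyond \<open>k\<close> are never used.
\<close>

definition hpoly :: "nat \<Rightarrow> (nat \<Rightarrow> complex^'n^'n) \<Rightarrow> complex \<Rightarrow> complex \<Rightarrow> complex^'n^'n" where
  "hpoly k B \<alpha> \<beta> = (\<Sum>i=0..k. smat (\<alpha>^i * \<beta>^(k-i)) (B i))"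

definition regular_hpoly :: "nat \<Rightarrow> (nat \<Rightarrow> complex^'n^'n) \<Rightarrow> bool" where
  "regular_hpoly k B \<longleftrightarrow> (\<exists>\<alpha> \<beta>. det (hpoly k B \<alpha> \<beta>) \<noteq> 0)"

definition moebius_transform ::
    "complex^2^2 \<Rightarrow> nat \<Rightarrow> (nat \<Rightarrow> complex^'n^'n) \<Rightarrow> complex \<Rightarrow> complex \<Rightarrow> complex^'n^'n" where
  "moebius_transform A k B \<gamma> \<delta> =
    (\<Sum>i=0..k. smat ((A$1$1 * \<gamma> + A$1$2 * \<delta>)^i * (A$2$1 * \<gamma> + A$2$2 * \<delta>)^(k-i)) (B i))"

definition line :: "complex^2 \<Rightarrow> (complex^2) set" where
  "line v = vec.span {v}"

text \<open>
  The approximate eigenvalue is the line \<open>L\<close>. The eigenvalue equation is imposed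
  for all representatives (nonzero vectors) of \<open>L\<close>; by homogeneity it holds for
  all of them as soon as it holds for one. The minimum is expressed by \<open>LEAST\<close>.
\<close>

definition eta_right ::
    "(nat \<Rightarrow> real) \<Rightarrow> nat \<Rightarrow> (nat \<Rightarrow> complex^'n^'n) \<Rightarrow> complex^'n \<Rightarrow> (complex^2) set \<Rightarrow> real" where
  "eta_right \<omega> k B x L =
    (LEAST \<epsilon>. \<exists>\<Delta>B :: nat \<Rightarrow> complex^'n^'n.
       (\<forall>u\<in>L - {0}. (hpoly k B (u$1) (u$2) + hpoly k \<Delta>B (u$1) (u$2)) *v x = 0) \<and>
       (\<forall>i\<in>{0..k}. spec_norm (\<Delta>B i) \<le> \<epsilon> * \<omega> i))"

definition eta_left ::
    "(nat \<Rightarrow> real) \<Rightarrow> nat \<Rightarrow> (nat \<Rightarrow> complex^'n^'n) \<Rightarrow> complex^'n \<Rightarrow> (complex^2) set \<Rightarrow> real" where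
  "eta_left \<omega> k B y L =
    (LEAST \<epsilon>. \<exists>\<Delta>B :: nat \<Rightarrow> complex^'n^'n.
       (\<forall>u\<in>L - {0}. conj_vec y v* (hpoly k B (u$1) (u$2) + hpoly k \<Delta>B (u$1) (u$2)) = 0) \<and>
       (\<forall>i\<in>{0..k}. spec_norm (\<Delta>B i) \<le> \<epsilon> * \<omega> i))"

definition max_coeff :: "nat \<Rightarrow> (nat \<Rightarrow> complex^'n^'n) \<Rightarrow> real" where
  "max_coeff k B = Max ((\<lambda>j. spec_norm (B j)) ` {0..k})"

text \<open>The three choices of weights (\<open>a\<close>, \<open>p\<close> and \<open>r\<close>).\<close>

definition weight_a :: "nat \<Rightarrow> (nat \<Rightarrow> complex^'n^'n) \<Rightarrow> nat \<Rightarrow> real" where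
  "weight_a k B i = 1"

definition weight_p :: "nat \<Rightarrow> (nat \<Rightarrow> complex^'n^'n) \<Rightarrow> nat \<Rightarrow> real" where
  "weight_p k B i = max_coeff k B"

definition weight_r :: "nat \<Rightarrow> (nat \<Rightarrow> complex^'n^'n) \<Rightarrow> nat \<Rightarrow> real" where
  "weight_r k B i = spec_norm (B i)"

text \<open>
  In the quotients, \<open>W\<close> is one of the three weight functions, \<open>B\<close> and \<open>Bt\<close> are the
  coefficients of a polynomial and of its Moebius transform under \<open>A\<close>, and \<open>v\<close>
  spans the approximate eigenvalue of the latter.
\<close>

definition Q_right ::
    "(nat \<Rightarrow> (nat \<Rightarrow> complex^'n^'n) \<Rightarrow> nat \<Rightarrow> real) \<Rightarrow> nat \<Rightarrow> (nat \<Rightarrow> complex^'n^'n) \<Rightarrow>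
     (nat \<Rightarrow> complex^'n^'n) \<Rightarrow> complex^2^2 \<Rightarrow> complex^'n \<Rightarrow> complex^2 \<Rightarrow> real" where
  "Q_right W k B Bt A x v =
    eta_right (W k B) k B x (line (A *v v)) / eta_right (W k Bt) k Bt x (line v)"

definition Q_left ::
    "(nat \<Rightarrow> (nat \<Rightarrow> complex^'n^'n) \<Rightarrow> nat \<Rightarrow> real) \<Rightarrow> nat \<Rightarrow> (nat \<Rightarrow> complex^'n^'n) \<Rightarrow>
     (nat \<Rightarrow> complex^'n^'n) \<Rightarrow> complex^2^2 \<Rightarrow> complex^'n \<Rightarrow> complex^2 \<Rightarrow> real" where
  "Q_left W k B Bt A y v =
    eta_left (W k B) k B y (line (A *v v)) / eta_left (W k Bt) k Bt y (line v)"

text \<open>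
  The assertion \<open>lo \<le> Q_right = Q_left \<le> hi\<close>. A quotient is only considered when its
  denominator is nonzero (HOL would otherwise give it the value 0), so each bound
  requires only its own quotient to be defined and the equality requires both.
\<close>

definition quotients_between ::
    "real \<Rightarrow> real \<Rightarrow> (nat \<Rightarrow> (nat \<Rightarrow> complex^'n^'n) \<Rightarrow> nat \<Rightarrow> real) \<Rightarrow> nat \<Rightarrow>
     (nat \<Rightarrow> complex^'n^'n) \<Rightarrow> (nat \<Rightarrow> complex^'n^'n) \<Rightarrow> complex^2^2 \<Rightarrow>
     complex^'n \<Rightarrow> complex^'n \<Rightarrow> complex^2 \<Rightarrow> bool" where
  "quotients_between lo hi W k B Bt A x y v \<longleftrightarrow>
    (eta_right (W k Bt) k Bt x (line v) \<noteq> 0 \<longrightarrow>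
       lo \<le> Q_right W k B Bt A x v \<and> Q_right W k B Bt A x v \<le> hi) \<and>
    (eta_left (W k Bt) k Bt y (line v) \<noteq> 0 \<longrightarrow>
       lo \<le> Q_left W k B Bt A y v \<and> Q_left W k B Bt A y v \<le> hi) \<and>
    (eta_right (W k Bt) k Bt x (line v) \<noteq> 0 \<and> eta_left (W k Bt) k Bt y (line v) \<noteq> 0 \<longrightarrow>
       Q_right W k B Bt A x v = Q_left W k B Bt A y v)"

definition Y_const :: "nat \<Rightarrow> real" where
  "Y_const k = (real k + 1)^2 * real (k choose (k div 2))"

definition coeff_ratio :: "nat \<Rightarrow> (nat \<Rightarrow> complex^'n^'n) \<Rightarrow> real" where
  "coeff_ratio k B = max_coeff k B / min (spec_norm (B 0)) (spec_norm (B k))"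

end

theory Submission
  imports Defs
begin

text \<open>
  With the weighted sum \<open>S(u) = \<Sum>i |u\<^sub>1|^i |u\<^sub>2|^(k-i) \<omega>\<^sub>i\<close>, the backward error of a right eigenpair is
  \<open>\<parallel>P(u) x\<parallel> / (S(u) \<parallel>x\<parallel>)\<close>, and left eigenpairs reduce to right ones by transposition. Since the
  Moebius transform at \<open>v\<close> equals \<open>P\<close> at \<open>A v\<close>, the residuals cancel in the quotients, leaving the same
  ratio of weighted sums at \<open>v\<close> and at \<open>A v\<close> on both sides. Each weighted sum lies between
  \<open>min(\<omega>\<^sub>0, \<omega>\<^sub>k)\<close> and \<open>(k + 1) max \<omega>\<^sub>i\<close> times the \<open>k\<close>-th power of the maximum norm, which changes under
  \<open>A\<close> by factors controlled by \<open>inf_norm\<close>. The coefficients of the transform are compared with those of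
  \<open>P\<close>, and conversely through the inverse matrix, by bounding the coefficients of
  \<open>(a z + b)^i (c z + d)^(k-i)\<close> by binomial coefficients.
\<close>

subsection \<open>Spectral norm\<close>

lemma bounded_linear_matrix_vector_complex [simp]:
  "bounded_linear ((*v) (M :: complex^'n^'m))"
  by (rule matrix_vector_mul_bounded_linear)

lemma norm_vector_scalar_mult_complex [simp]:
  fixes x :: "complex^'n"
  shows "norm (c *s x) = norm c * norm x"
  by (simp add: norm_vec_def norm_mult L2_set_right_distrib)

lemma norm_vector_smult_sum_le:
  fixes f :: "'i \<Rightarrow> complex" and g :: "'i \<Rightarrow> complex^'n"
  assumes "\<And>i. i \<in> I \<Longrightarrow> norm (f i) * norm (g i) \<le> h i"
  shows "norm (\<Sum>i\<in>I. f i *s g i) \<le> sum h I"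
  by (rule sum_norm_le) (use assms in simp)

text \<open>The sum carries no conjugation, so it is not an inner product. Taking norms term by term
  leaves two real vectors, to which the l2 inequality applies.\<close>

lemma Cauchy_Schwarz_complex_vec:
  fixes x y :: "complex^'n"
  shows "norm (\<Sum>i\<in>UNIV. x $ i * y $ i) \<le> norm x * norm y"
proof -
  have "norm (\<Sum>i\<in>UNIV. x $ i * y $ i) \<le> (\<Sum>i\<in>UNIV. \<bar>norm (x $ i)\<bar> * \<bar>norm (y $ i)\<bar>)"
    by (rule sum_norm_le) (simp add: norm_mult)
  also have "\<dots> \<le> norm x * norm y"
    unfolding norm_vec_def by (rule L2_set_mult_ineq)
  finally show ?thesis .
qed

lemma conj_vec_dot_self:
  "(\<Sum>i\<in>UNIV. conj_vec x $ i * x $ i) = complex_of_real ((norm x)\<^sup>2)"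
proof -
  have "(norm x)\<^sup>2 = (\<Sum>i\<in>UNIV. (norm (x $ i))\<^sup>2)"
    by (simp add: norm_vec_def L2_set_def sum_nonneg)
  then have "complex_of_real ((norm x)\<^sup>2) = (\<Sum>i\<in>UNIV. complex_of_real ((norm (x $ i))\<^sup>2))"
    by simp
  then show ?thesis
    unfolding complex_norm_square by (simp add: conj_vec_def mult.commute)
qed

lemma norm_conj_vec [simp]: "norm (conj_vec x) = norm x"
  by (simp add: conj_vec_def norm_vec_def)

lemma conj_vec_eq_0_iff [simp]: "conj_vec x = 0 \<longleftrightarrow> x = 0"
  by (metis norm_conj_vec norm_eq_zero)

lemma spec_norm_nonneg [simp]: "0 \<le> spec_norm M"
  unfolding spec_norm_def by (rule onorm_pos_le) simp

lemma norm_matrix_vector_le: "norm (M *v x) \<le> spec_norm M * norm x"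
  unfolding spec_norm_def by (rule onorm) simp

lemma spec_norm_le:
  assumes "\<And>x. norm (M *v x) \<le> c * norm x"
  shows "spec_norm M \<le> c"
  unfolding spec_norm_def by (rule onorm_le) (rule assms)

lemma spec_norm_eq_0_iff [simp]: "spec_norm M = 0 \<longleftrightarrow> M = 0"
  unfolding spec_norm_def by (subst onorm_eq_0) (auto simp: matrix_eq)

lemma spec_norm_pos_iff: "0 < spec_norm M \<longleftrightarrow> M \<noteq> 0"
  using spec_norm_nonneg [of M] spec_norm_eq_0_iff [of M] by linarith

text \<open>A duality argument: pairing \<open>w = y v* M\<close> with its own conjugate turns the
  squared norm of \<open>w\<close> into the pairing of \<open>y\<close> with
  \<open>M *v conj_vec w\<close>. Cauchy-Schwarz and division by \<open>norm w\<close>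
  finish.\<close>

lemma norm_vector_matrix_le:
  fixes M :: "complex^'n^'m"
  shows "norm (y v* M) \<le> spec_norm M * norm y"
proof (cases "y v* M = 0")
  case False
  let ?w = "y v* M"
  have "complex_of_real ((norm ?w)\<^sup>2) = (\<Sum>j\<in>UNIV. ?w $ j * conj_vec ?w $ j)"
    unfolding conj_vec_dot_self [symmetric] by (simp add: mult.commute)
  also have "\<dots> = (\<Sum>j\<in>UNIV. \<Sum>i\<in>UNIV. y $ i * (M $ i $ j * conj_vec ?w $ j))"
    by (simp add: vector_matrix_mult_def sum_distrib_right mult.assoc)
  also have "\<dots> = (\<Sum>i\<in>UNIV. y $ i * (M *v conj_vec ?w) $ i)"
    by (subst sum.swap) (simp add: matrix_vector_mult_def sum_distrib_left)
  finally have "(norm ?w)\<^sup>2 = norm (\<Sum>i\<in>UNIV. y $ i * (M *v conj_vec ?w) $ i)"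
    by (metis norm_of_real abs_power2 abs_of_nonneg zero_le_power2)
  also have "\<dots> \<le> norm y * norm (M *v conj_vec ?w)"
    by (rule Cauchy_Schwarz_complex_vec)
  also have "\<dots> \<le> norm y * (spec_norm M * norm ?w)"
    using norm_matrix_vector_le [of M "conj_vec ?w"] by (simp add: mult_left_mono)
  finally show ?thesis
    using False by (simp add: power2_eq_square mult.commute mult.left_commute)
qed simp

text \<open>Transposing a perturbation does not change its cost, which is what the reduction of left
  eigenpairs to right ones rests on.\<close>

lemma spec_norm_transpose [simp]: "spec_norm (transpose M) = spec_norm M"
proof -
  have "spec_norm (transpose N) \<le> spec_norm N" for N :: "complex^'m^'k"
    by (rule spec_norm_le) (simp add: norm_vector_matrix_le)
  from this [of M] this [of "transpose M"] show ?thesis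
    by simp
qed

lemma smat_mult_vec: "smat c M *v x = c *s (M *v x)"
  by (simp add: smat_def matrix_vector_mult_def vec_eq_iff sum_distrib_left mult.assoc)

lemma spec_norm_smat_le: "spec_norm (smat c M) \<le> norm c * spec_norm M"
  by (rule spec_norm_le)
    (simp add: smat_mult_vec mult.assoc mult_left_mono norm_matrix_vector_le)

lemma sum_matrix_mult_vec:
  fixes F :: "'i \<Rightarrow> complex^'n^'m"
  shows "(\<Sum>i\<in>I. F i) *v x = (\<Sum>i\<in>I. F i *v x)"
  by (induction I rule: infinite_finite_induct) (auto simp: matrix_vector_mult_add_rdistrib)

lemma spec_norm_sum_le:
  fixes F :: "'i \<Rightarrow> complex^'n^'m"
  shows "spec_norm (\<Sum>i\<in>I. F i) \<le> (\<Sum>i\<in>I. spec_norm (F i))"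
  by (rule spec_norm_le)
    (auto simp: sum_matrix_mult_vec sum_distrib_right intro!: sum_norm_le norm_matrix_vector_le)

text \<open>Neither factor is conjugated here, so \<open>outer r (conj_vec x)\<close> is the
  rank-one matrix r x^*, with the conjugate transpose of x.\<close>

definition outer :: "complex^'m \<Rightarrow> complex^'n \<Rightarrow> complex^'n^'m" where
  "outer u w = (\<chi> i j. u $ i * w $ j)"

lemma outer_mult_vec: "outer u w *v x = (\<Sum>j\<in>UNIV. w $ j * x $ j) *s u"
  by (simp add: outer_def matrix_vector_mult_def vec_eq_iff sum_distrib_left mult_ac)

lemma spec_norm_outer_le: "spec_norm (outer u w) \<le> norm u * norm w"
proof (rule spec_norm_le)
  fix x
  have "norm (outer u w *v x) \<le> norm w * norm x * norm u"
    by (simp add: outer_mult_vec mult_right_mono Cauchy_Schwarz_complex_vec)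
  then show "norm (outer u w *v x) \<le> norm u * norm w * norm x"
    by (simp add: mult_ac)
qed

subsection \<open>Explicit formulas for the backward errors\<close>

lemma hpoly_mult_vec:
  "hpoly k B \<alpha> \<beta> *v x = (\<Sum>i=0..k. (\<alpha>^i * \<beta>^(k-i)) *s (B i *v x))"
  by (simp add: hpoly_def sum_matrix_mult_vec smat_mult_vec)

lemma hpoly_scale:
  fixes B :: "nat \<Rightarrow> complex^'n^'n"
  shows "hpoly k B (c * \<alpha>) (c * \<beta>) = smat (c ^ k) (hpoly k B \<alpha> \<beta>)"
proof -
  \<comment> \<open>Subtraction of naturals truncates; \<open>i \<in> {0..k}\<close> is what makes
    the exponents \<open>i\<close> and \<open>k - i\<close> add up to \<open>k\<close>.\<close>
  have "(c * \<alpha>)^i * (c * \<beta>)^(k-i) = c ^ k * (\<alpha>^i * \<beta>^(k-i))" if "i \<in> {0..k}" for i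
    using that power_add [of c i "k - i"] by (simp add: power_mult_distrib)
  then have "smat ((c * \<alpha>)^i * (c * \<beta>)^(k-i)) M = smat (c ^ k) (smat (\<alpha>^i * \<beta>^(k-i)) M)"
    if "i \<in> {0..k}" for i and M :: "complex^'n^'n"
    using that by (simp add: smat_def mult.assoc)
  then have "hpoly k B (c * \<alpha>) (c * \<beta>) = (\<Sum>i=0..k. smat (c ^ k) (smat (\<alpha>^i * \<beta>^(k-i)) (B i)))"
    unfolding hpoly_def by (intro sum.cong) auto
  then show ?thesis
    by (simp add: hpoly_def smat_def vec_eq_iff sum_distrib_left)
qed

lemma hpoly_transpose:
  "hpoly k (\<lambda>i. transpose (B i)) \<alpha> \<beta> = transpose (hpoly k B \<alpha> \<beta>)"
  by (simp add: hpoly_def smat_def transpose_def vec_eq_iff)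

definition wsum :: "(nat \<Rightarrow> real) \<Rightarrow> nat \<Rightarrow> complex^2 \<Rightarrow> real" where
  "wsum \<omega> k u = (\<Sum>i=0..k. norm (u$1) ^ i * norm (u$2) ^ (k-i) * \<omega> i)"

text \<open>An admissible perturbation must cancel the residual, so its own value at
  \<open>x\<close> has the same norm, and the triangle inequality limits that norm. This is the
  lower bound for the backward error.\<close>

lemma residual_le_wsum:
  assumes "(hpoly k B (u$1) (u$2) + hpoly k D (u$1) (u$2)) *v x = 0"
    and "\<forall>i\<in>{0..k}. spec_norm (D i) \<le> \<epsilon> * \<omega> i"
  shows "norm (hpoly k B (u$1) (u$2) *v x) \<le> \<epsilon> * wsum \<omega> k u * norm x"
proof -
  have "hpoly k B (u$1) (u$2) *v x = - (hpoly k D (u$1) (u$2) *v x)"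
    using assms(1) by (simp add: matrix_vector_mult_add_rdistrib add_eq_0_iff2)
  then have "norm (hpoly k B (u$1) (u$2) *v x) =
      norm (\<Sum>i=0..k. ((u$1)^i * (u$2)^(k-i)) *s (D i *v x))"
    by (simp add: hpoly_mult_vec)
  also have "\<dots> \<le> (\<Sum>i=0..k. norm (u$1) ^ i * norm (u$2) ^ (k-i) * (\<epsilon> * \<omega> i * norm x))"
  proof (rule norm_vector_smult_sum_le)
    fix i assume "i \<in> {0..k}"
    then have "norm (D i *v x) \<le> \<epsilon> * \<omega> i * norm x"
      using assms(2) by (intro order_trans [OF norm_matrix_vector_le] mult_right_mono) auto
    then show "norm ((u$1)^i * (u$2)^(k-i)) * norm (D i *v x)
        \<le> norm (u$1) ^ i * norm (u$2) ^ (k-i) * (\<epsilon> * \<omega> i * norm x)"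
      by (simp add: norm_mult norm_power mult_left_mono)
  qed
  also have "\<dots> = \<epsilon> * wsum \<omega> k u * norm x"
    by (simp add: wsum_def sum_distrib_left sum_distrib_right mult_ac)
  finally show ?thesis .
qed

text \<open>
  The minimal perturbation distributes the rank-one matrix that cancels the residual over the
  coefficients in proportion to the weights, with phases that make all contributions add up.
\<close>

lemma optimal_perturbation:
  fixes B :: "nat \<Rightarrow> complex^'n^'n"
  assumes x: "x \<noteq> 0" and nonneg: "\<And>i. i \<le> k \<Longrightarrow> 0 \<le> \<omega> i" and pos: "0 < wsum \<omega> k u"
  obtains D where "(hpoly k B (u$1) (u$2) + hpoly k D (u$1) (u$2)) *v x = 0"
    and "\<forall>i\<in>{0..k}. spec_norm (D i) \<le>
      norm (hpoly k B (u$1) (u$2) *v x) / (wsum \<omega> k u * norm x) * \<omega> i"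
proof -
  define p where "p i = (u$1)^i * (u$2)^(k-i)" for i
  define r where "r = hpoly k B (u$1) (u$2) *v x"
  \<comment> \<open>The conjugate phase makes every \<open>p i * c i\<close> real and nonpositive,
    so nothing is lost to cancellation in the sum. Terms with \<open>p i = 0\<close> get
    \<open>c i = 0\<close>, because \<open>sgn 0 = 0\<close>.\<close>
  define c where "c i = - cnj (sgn (p i)) * of_real (\<omega> i / (wsum \<omega> k u * (norm x)\<^sup>2))" for i
  define D where "D i = smat (c i) (outer r (conj_vec x))" for i
  have pc: "p i * c i = - of_real (norm (p i) * \<omega> i / (wsum \<omega> k u * (norm x)\<^sup>2))" for i
  proof -
    have "p i * cnj (sgn (p i)) = of_real (norm (p i))"
    proof (cases "p i = 0")
      case False
      then show ?thesis
        using complex_norm_square [of "p i"]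
        by (simp add: sgn_eq field_simps power2_eq_square)
    qed simp
    then show ?thesis
      by (simp add: c_def mult.assoc [symmetric])
  qed
  have "(\<Sum>i=0..k. p i * c i) = - of_real ((\<Sum>i=0..k. norm (p i) * \<omega> i) / (wsum \<omega> k u * (norm x)\<^sup>2))"
    unfolding pc by (simp add: sum_negf sum_divide_distrib)
  also have "\<dots> = - of_real (1 / (norm x)\<^sup>2)"
    using pos by (simp add: wsum_def p_def norm_mult norm_power)
  finally have sum_pc: "(\<Sum>i=0..k. p i * c i) = - of_real (1 / (norm x)\<^sup>2)" .
  \<comment> \<open>The rank-one matrix sends \<open>x\<close> to \<open>(norm x)\<^sup>2\<close>
    times \<open>r\<close>, and the coefficients sum to minus the reciprocal of that factor, so the
    value is \<open>- r\<close>.\<close>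
  have "hpoly k D (u$1) (u$2) *v x = (\<Sum>i=0..k. (p i * c i) *s (of_real ((norm x)\<^sup>2) *s r))"
    by (simp add: hpoly_mult_vec D_def smat_mult_vec outer_mult_vec conj_vec_dot_self p_def
        vector_smult_assoc mult.assoc)
  also have "\<dots> = (\<Sum>i=0..k. p i * c i) *s (of_real ((norm x)\<^sup>2) *s r)"
    by (simp add: vec_eq_iff sum_distrib_right)
  also have "\<dots> = - r"
    using x unfolding sum_pc by (simp add: vector_smult_assoc)
  finally have "(hpoly k B (u$1) (u$2) + hpoly k D (u$1) (u$2)) *v x = 0"
    by (simp add: matrix_vector_mult_add_rdistrib r_def)
  moreover have "spec_norm (D i) \<le> norm r / (wsum \<omega> k u * norm x) * \<omega> i" if "i \<in> {0..k}" for i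
  proof -
    have "norm (c i) \<le> \<omega> i / (wsum \<omega> k u * (norm x)\<^sup>2)"
    proof -
      have "norm (c i) = norm (sgn (p i)) * \<bar>\<omega> i / (wsum \<omega> k u * (norm x)\<^sup>2)\<bar>"
        by (simp only: c_def norm_mult norm_minus_cancel complex_mod_cnj norm_of_real)
      \<comment> \<open>Only an inequality: the phase has norm 0 instead of 1 when
        \<open>p i\<close> vanishes.\<close>
      also have "\<dots> \<le> 1 * \<bar>\<omega> i / (wsum \<omega> k u * (norm x)\<^sup>2)\<bar>"
        by (rule mult_right_mono) (simp_all add: norm_sgn)
      also have "\<dots> = \<omega> i / (wsum \<omega> k u * (norm x)\<^sup>2)"
        using that nonneg pos by simp
      finally show ?thesis .
    qed
    moreover have "spec_norm (outer r (conj_vec x)) \<le> norm r * norm x"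
      using spec_norm_outer_le [of r "conj_vec x"] by simp
    ultimately have "norm (c i) * spec_norm (outer r (conj_vec x))
        \<le> \<omega> i / (wsum \<omega> k u * (norm x)\<^sup>2) * (norm r * norm x)"
      using that nonneg pos by (intro mult_mono) auto
    then have "spec_norm (D i) \<le> \<omega> i / (wsum \<omega> k u * (norm x)\<^sup>2) * (norm r * norm x)"
      unfolding D_def by (rule order_trans [OF spec_norm_smat_le])
    also have "\<dots> = norm r / (wsum \<omega> k u * norm x) * \<omega> i"
      using x by (simp add: power2_eq_square)
    finally show ?thesis .
  qed
  ultimately show ?thesis
    using that unfolding r_def by blast
qed

lemma line_eq: "line u = range (\<lambda>c. c *s u)"
  by (simp add: line_def vec.span_singleton)

lemma self_mem_line: "u \<in> line u"
  unfolding line_def by (simp add: vec.span_base)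

text \<open>By homogeneity, passing from \<open>u\<close> to \<open>c *s u\<close> multiplies both
  polynomial values by \<open>c ^ k\<close>. A perturbation that works for one representative thus
  meets the condition for all of them.\<close>

lemma hpoly_annihilates_on_line:
  assumes "w \<in> line u"
    and "(hpoly k B (u$1) (u$2) + hpoly k D (u$1) (u$2)) *v x = 0"
  shows "(hpoly k B (w$1) (w$2) + hpoly k D (w$1) (w$2)) *v x = 0"
proof -
  obtain c where "w = c *s u"
    using assms(1) by (auto simp: line_eq)
  then have "(hpoly k B (w$1) (w$2) + hpoly k D (w$1) (w$2)) *v x
      = c ^ k *s ((hpoly k B (u$1) (u$2) + hpoly k D (u$1) (u$2)) *v x)"
    by (simp add: hpoly_scale matrix_vector_mult_add_rdistrib smat_mult_vec vector_add_ldistrib)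
  then show ?thesis
    using assms(2) by simp
qed

text \<open>The quotient is attained by \<open>optimal_perturbation\<close> and is a lower bound by
  \<open>residual_le_wsum\<close>. Since \<open>u\<close> is nonzero, it is itself a representative
  at which the eigenvalue equation can be used.\<close>

lemma eta_right_eq:
  fixes B :: "nat \<Rightarrow> complex^'n^'n"
  assumes "x \<noteq> 0" and "u \<noteq> 0" and "\<And>i. i \<le> k \<Longrightarrow> 0 \<le> \<omega> i" and "0 < wsum \<omega> k u"
  shows "eta_right \<omega> k B x (line u) =
    norm (hpoly k B (u$1) (u$2) *v x) / (wsum \<omega> k u * norm x)"
  unfolding eta_right_def
proof (rule Least_equality)
  obtain D where "(hpoly k B (u$1) (u$2) + hpoly k D (u$1) (u$2)) *v x = 0"
    and "\<forall>i\<in>{0..k}. spec_norm (D i) \<le>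
      norm (hpoly k B (u$1) (u$2) *v x) / (wsum \<omega> k u * norm x) * \<omega> i"
    using optimal_perturbation [OF assms(1,3,4)] by blast
  then show "\<exists>D :: nat \<Rightarrow> complex^'n^'n.
       (\<forall>w\<in>line u - {0}. (hpoly k B (w$1) (w$2) + hpoly k D (w$1) (w$2)) *v x = 0) \<and>
       (\<forall>i\<in>{0..k}. spec_norm (D i) \<le>
          norm (hpoly k B (u$1) (u$2) *v x) / (wsum \<omega> k u * norm x) * \<omega> i)"
    using hpoly_annihilates_on_line by blast
next
  fix \<epsilon>
  assume "\<exists>D :: nat \<Rightarrow> complex^'n^'n.
       (\<forall>w\<in>line u - {0}. (hpoly k B (w$1) (w$2) + hpoly k D (w$1) (w$2)) *v x = 0) \<and>
       (\<forall>i\<in>{0..k}. spec_norm (D i) \<le> \<epsilon> * \<omega> i)"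
  then obtain D :: "nat \<Rightarrow> complex^'n^'n"
    where "(hpoly k B (u$1) (u$2) + hpoly k D (u$1) (u$2)) *v x = 0"
      and "\<forall>i\<in>{0..k}. spec_norm (D i) \<le> \<epsilon> * \<omega> i"
    using self_mem_line [of u] assms(2) by blast
  then have "norm (hpoly k B (u$1) (u$2) *v x) \<le> \<epsilon> * wsum \<omega> k u * norm x"
    by (rule residual_le_wsum)
  then show "norm (hpoly k B (u$1) (u$2) *v x) / (wsum \<omega> k u * norm x) \<le> \<epsilon>"
    using assms(1,4) by (simp add: divide_le_eq mult.assoc)
qed

text \<open>Transposing all perturbation coefficients matches the two feasible sets for every fixed
  \<open>\<epsilon>\<close>, so the least elements coincide.\<close>

lemma eta_left_eq_eta_right_transpose:
  fixes B :: "nat \<Rightarrow> complex^'n^'n"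
  shows "eta_left \<omega> k B y L = eta_right \<omega> k (\<lambda>i. transpose (B i)) (conj_vec y) L"
proof -
  have "(\<exists>D :: nat \<Rightarrow> complex^'n^'n.
       (\<forall>u\<in>L - {0}. conj_vec y v* (hpoly k B (u$1) (u$2) + hpoly k D (u$1) (u$2)) = 0) \<and>
       (\<forall>i\<in>{0..k}. spec_norm (D i) \<le> \<epsilon> * \<omega> i)) \<longleftrightarrow>
     (\<exists>D :: nat \<Rightarrow> complex^'n^'n.
       (\<forall>u\<in>L - {0}. (hpoly k (\<lambda>i. transpose (B i)) (u$1) (u$2) + hpoly k D (u$1) (u$2))
          *v conj_vec y = 0) \<and>
       (\<forall>i\<in>{0..k}. spec_norm (D i) \<le> \<epsilon> * \<omega> i))"
    (is "?l \<longleftrightarrow> ?r") for \<epsilon>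
  proof
    assume ?l
    then obtain D :: "nat \<Rightarrow> complex^'n^'n" where
      "\<forall>u\<in>L - {0}. conj_vec y v* (hpoly k B (u$1) (u$2) + hpoly k D (u$1) (u$2)) = 0"
      "\<forall>i\<in>{0..k}. spec_norm (D i) \<le> \<epsilon> * \<omega> i" by blast
    then show ?r
      by (intro exI [of _ "\<lambda>i. transpose (D i)"])
        (simp add: hpoly_transpose vector_matrix_mult_add_rdistrib matrix_vector_mult_add_rdistrib)
  next
    assume ?r
    then obtain D :: "nat \<Rightarrow> complex^'n^'n" where
      "\<forall>u\<in>L - {0}. (hpoly k (\<lambda>i. transpose (B i)) (u$1) (u$2) + hpoly k D (u$1) (u$2))
          *v conj_vec y = 0"
      "\<forall>i\<in>{0..k}. spec_norm (D i) \<le> \<epsilon> * \<omega> i" by blast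
    then show ?l
      by (intro exI [of _ "\<lambda>i. transpose (D i)"])
        (simp add: hpoly_transpose vector_matrix_mult_add_rdistrib matrix_vector_mult_add_rdistrib)
  qed
  then show ?thesis
    unfolding eta_left_def eta_right_def by simp
qed

lemma eta_left_eq:
  assumes "y \<noteq> 0" and "u \<noteq> 0" and "\<And>i. i \<le> k \<Longrightarrow> 0 \<le> \<omega> i" and "0 < wsum \<omega> k u"
  shows "eta_left \<omega> k B y (line u) =
    norm (conj_vec y v* hpoly k B (u$1) (u$2)) / (wsum \<omega> k u * norm y)"
  using eta_right_eq [of "conj_vec y" u k \<omega> "\<lambda>i. transpose (B i)"] assms
  by (simp add: eta_left_eq_eta_right_transpose hpoly_transpose)

subsection \<open>Bounds for the weighted sums\<close>

text \<open>The maximum norm is used on pairs because \<open>inf_norm\<close> is the operator norm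
  that it induces.\<close>

definition max_norm2 :: "complex^2 \<Rightarrow> real" where
  "max_norm2 u = max (norm (u$1)) (norm (u$2))"

lemma max_norm2_pos: "u \<noteq> 0 \<Longrightarrow> 0 < max_norm2 u"
  by (auto simp: max_norm2_def vec_eq_iff forall_2 less_max_iff_disj)

lemma inf_norm_2:
  fixes A :: "complex^2^2"
  shows "inf_norm A = max (norm (A$1$1) + norm (A$1$2)) (norm (A$2$1) + norm (A$2$2))"
  by (simp add: inf_norm_def UNIV_2 sum_2)

lemma norm_entry_le_inf_norm:
  fixes A :: "complex^2^2"
  shows "norm (A$i$j) \<le> inf_norm A"
proof -
  have "norm (A$1$1) \<le> inf_norm A \<and> norm (A$1$2) \<le> inf_norm A \<and>
      norm (A$2$1) \<le> inf_norm A \<and> norm (A$2$2) \<le> inf_norm A"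
    unfolding inf_norm_2 by (simp add: le_max_iff_disj)
  then show ?thesis
    using exhaust_2 [of i] exhaust_2 [of j] by auto
qed

lemma inf_norm_nonneg:
  fixes A :: "complex^2^2"
  shows "0 \<le> inf_norm A"
  by (rule order_trans [OF norm_ge_zero norm_entry_le_inf_norm [of A 1 1]])

lemma max_norm2_matrix_vector_le:
  fixes A :: "complex^2^2"
  shows "max_norm2 (A *v u) \<le> inf_norm A * max_norm2 u"
proof -
  have "norm ((A *v u) $ i) \<le> inf_norm A * max_norm2 u" for i
  proof -
    have "norm ((A *v u) $ i) \<le> norm (A$i$1) * norm (u$1) + norm (A$i$2) * norm (u$2)"
      by (simp add: matrix_vector_mult_def sum_2) (metis norm_mult norm_triangle_ineq)
    also have "\<dots> \<le> norm (A$i$1) * max_norm2 u + norm (A$i$2) * max_norm2 u"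
      by (intro add_mono mult_left_mono) (auto simp: max_norm2_def)
    also have "\<dots> = (norm (A$i$1) + norm (A$i$2)) * max_norm2 u"
      by (simp add: distrib_right)
    also have "\<dots> \<le> inf_norm A * max_norm2 u"
      using exhaust_2 [of i]
      by (intro mult_right_mono) (auto simp: inf_norm_2 max_norm2_def le_max_iff_disj)
    finally show ?thesis .
  qed
  then show ?thesis
    by (simp add: max_norm2_def [of "A *v u"])
qed

lemma wsum_le:
  assumes "\<And>i. i \<le> k \<Longrightarrow> \<omega> i \<le> W" and "0 \<le> W"
  shows "wsum \<omega> k u \<le> (real k + 1) * W * max_norm2 u ^ k"
proof -
  have "norm (u$1) ^ i * norm (u$2) ^ (k-i) * \<omega> i \<le> max_norm2 u ^ k * W" if "i \<in> {0..k}" for i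
  proof -
    have "norm (u$1) ^ i * norm (u$2) ^ (k-i) \<le> max_norm2 u ^ i * max_norm2 u ^ (k-i)"
      by (intro mult_mono power_mono) (auto simp: max_norm2_def le_max_iff_disj)
    also have "\<dots> = max_norm2 u ^ k"
      using that by (simp flip: power_add)
    finally have "norm (u$1) ^ i * norm (u$2) ^ (k-i) * W \<le> max_norm2 u ^ k * W"
      using assms(2) by (rule mult_right_mono)
    moreover have "norm (u$1) ^ i * norm (u$2) ^ (k-i) * \<omega> i \<le> norm (u$1) ^ i * norm (u$2) ^ (k-i) * W"
      using that assms(1) by (intro mult_left_mono) auto
    ultimately show ?thesis
      by linarith
  qed
  then have "wsum \<omega> k u \<le> of_nat (card {0..k}) * (max_norm2 u ^ k * W)"
    unfolding wsum_def by (rule sum_bounded_above)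
  then show ?thesis
    by (simp add: mult_ac add.commute)
qed

text \<open>One term of the sum suffices: index 0 carries only powers of \<open>u$2\<close> and
  index \<open>k\<close> only powers of \<open>u$1\<close>, so the larger coordinate selects the
  term. Hence only the two extreme weights enter, and through them the minimum in
  \<open>coeff_ratio\<close>.\<close>

lemma wsum_ge:
  assumes "\<And>i. i \<le> k \<Longrightarrow> 0 \<le> \<omega> i" and "m \<le> \<omega> 0" and "m \<le> \<omega> k"
  shows "m * max_norm2 u ^ k \<le> wsum \<omega> k u"
proof -
  let ?f = "\<lambda>i. norm (u$1) ^ i * norm (u$2) ^ (k-i) * \<omega> i"
  have f_le: "?f i \<le> wsum \<omega> k u" if "i \<le> k" for i
    unfolding wsum_def using that assms(1) by (intro member_le_sum) auto
  show ?thesis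
  proof (cases "norm (u$1) \<le> norm (u$2)")
    case True
    then have "m * max_norm2 u ^ k \<le> ?f 0"
      using assms(2) by (simp add: max_norm2_def mult.commute mult_right_mono)
    then show ?thesis
      using f_le [of 0] by linarith
  next
    case False
    then have "m * max_norm2 u ^ k \<le> ?f k"
      using assms(3) by (simp add: max_norm2_def mult.commute mult_right_mono)
    then show ?thesis
      using f_le [of k] by linarith
  qed
qed

subsection \<open>Coefficients of the Moebius transform\<close>

text \<open>A coefficient of the product combines two neighbouring coefficients of \<open>p\<close>,
  and Pascal's rule adds their binomial bounds.\<close>

lemma norm_coeff_linear_factor_le:
  fixes p :: "complex poly"
  assumes "norm a \<le> m" and "norm b \<le> m" and "0 \<le> m"
    and "\<And>j. norm (coeff p j) \<le> real (n choose j) * m ^ n"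
  shows "norm (coeff ([:b, a:] * p) j) \<le> real (Suc n choose j) * m ^ Suc n"
proof (cases j)
  case 0
  then show ?thesis
    using assms mult_mono [OF assms(2) assms(4) [of 0]] by (simp add: norm_mult)
next
  case (Suc l)
  have "norm (coeff ([:b, a:] * p) j) \<le> norm b * norm (coeff p (Suc l)) + norm a * norm (coeff p l)"
    by (simp add: Suc) (metis norm_mult norm_triangle_ineq)
  also have "\<dots> \<le> m * (real (n choose Suc l) * m ^ n) + m * (real (n choose l) * m ^ n)"
    using assms by (intro add_mono mult_mono) auto
  also have "\<dots> = real (Suc n choose j) * m ^ Suc n"
    by (simp add: Suc algebra_simps)
  finally show ?thesis .
qed

text \<open>The bound is the corresponding coefficient of (m + m z)^(i+l); the factors are
  multiplied in one at a time, first those of the second power.\<close>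

lemma norm_coeff_linear_powers_le:
  fixes a b c d :: complex
  assumes "norm a \<le> m" "norm b \<le> m" "norm c \<le> m" "norm d \<le> m" "0 \<le> m"
  shows "norm (coeff ([:b, a:] ^ i * [:d, c:] ^ l) j) \<le> real (i + l choose j) * m ^ (i + l)"
proof (induction i arbitrary: j)
  case 0
  show ?case
  proof (induction l arbitrary: j)
    case 0
    show ?case by (cases j) auto
  next
    case (Suc l)
    show ?case
      using norm_coeff_linear_factor_le [of c m d "[:d, c:] ^ l" l j] Suc assms by simp
  qed
next
  case (Suc i)
  show ?case
    using norm_coeff_linear_factor_le [of a m b "[:b, a:] ^ i * [:d, c:] ^ l" "i + l" j] Suc assms
    by (simp only: power_Suc mult.assoc add_Suc)
qed

text \<open>Setting the second variable to 1 loses no coefficient. Entry by entry, both sides are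
  polynomials in \<open>z\<close> agreeing at every complex number, hence coefficientwise.\<close>

lemma hpoly_coeff_unique:
  fixes q :: "nat \<Rightarrow> complex poly"
  assumes eq: "\<And>z. hpoly k Bt z 1 = (\<Sum>i=0..k. smat (poly (q i) z) (B i))" and "j \<le> k"
  shows "Bt j = (\<Sum>i=0..k. smat (coeff (q i) j) (B i))"
proof -
  have "Bt j $ r $ s = (\<Sum>i=0..k. smat (coeff (q i) j) (B i)) $ r $ s" for r s
  proof -
    let ?p = "\<Sum>i=0..k. monom (Bt i $ r $ s) i" and ?q = "\<Sum>i=0..k. smult (B i $ r $ s) (q i)"
    have "poly ?p z = poly ?q z" for z
      using arg_cong [OF eq [of z], of "\<lambda>M. M $ r $ s"]
      by (simp add: hpoly_def smat_def poly_sum poly_monom mult.commute)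
    then have "?p = ?q"
      by (simp add: poly_eq_poly_eq_iff [symmetric] fun_eq_iff)
    then have "coeff ?p j = coeff ?q j"
      by simp
    then show ?thesis
      using assms(2) by (simp add: coeff_sum smat_def mult.commute)
  qed
  then show ?thesis
    by (simp add: vec_eq_iff)
qed

lemma spec_norm_le_max_coeff: "i \<le> k \<Longrightarrow> spec_norm (B i) \<le> max_coeff k B"
  unfolding max_coeff_def by (rule Max_ge) auto

lemma max_coeff_le: "(\<And>i. i \<le> k \<Longrightarrow> spec_norm (B i) \<le> c) \<Longrightarrow> max_coeff k B \<le> c"
  unfolding max_coeff_def by (subst Max_le_iff) auto

lemma max_coeff_nonneg: "0 \<le> max_coeff k B"
  using spec_norm_le_max_coeff [of 0 k B] spec_norm_nonneg [of "B 0"] by linarith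

text \<open>Each new coefficient is a sum of \<open>k + 1\<close> old ones, weighted by coefficients
  of products of linear forms; the central binomial coefficient bounds all binomials. As the
  assumption only relates values, it can also be met with \<open>matrix_inv A\<close> and the two
  polynomials exchanged.\<close>

lemma max_coeff_moebius_le:
  fixes A :: "complex^2^2"
  assumes "\<And>w. hpoly k Bt (w$1) (w$2) = hpoly k B ((A *v w)$1) ((A *v w)$2)"
  shows "max_coeff k Bt \<le> (real k + 1) * real (k choose (k div 2)) * inf_norm A ^ k * max_coeff k B"
proof (rule max_coeff_le)
  fix j assume j: "j \<le> k"
  define q where "q i = [:A$1$2, A$1$1:] ^ i * [:A$2$2, A$2$1:] ^ (k-i)" for i
  have "hpoly k Bt z 1 = (\<Sum>i=0..k. smat (poly (q i) z) (B i))" for z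
    using assms [of "vector [z, 1]"]
    by (simp add: hpoly_def q_def matrix_vector_mult_def sum_2 poly_power mult.commute add.commute)
  then have Bt: "Bt j = (\<Sum>i=0..k. smat (coeff (q i) j) (B i))"
    using j by (rule hpoly_coeff_unique)
  have q_le: "norm (coeff (q i) j) \<le> real (k choose (k div 2)) * inf_norm A ^ k" if "i \<in> {0..k}" for i
  proof -
    have "norm (coeff (q i) j) \<le> real (k choose j) * inf_norm A ^ k"
      unfolding q_def
      using norm_coeff_linear_powers_le
        [of "A$1$1" "inf_norm A" "A$1$2" "A$2$1" "A$2$2" i "k-i" j] that
      by (simp add: norm_entry_le_inf_norm inf_norm_nonneg)
    also have "\<dots> \<le> real (k choose (k div 2)) * inf_norm A ^ k"
      by (intro mult_right_mono) (simp_all add: binomial_maximum inf_norm_nonneg)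
    finally show ?thesis .
  qed
  have "spec_norm (Bt j) \<le> (\<Sum>i=0..k. spec_norm (smat (coeff (q i) j) (B i)))"
    unfolding Bt by (rule spec_norm_sum_le)
  also have "\<dots> \<le> of_nat (card {0..k}) * (real (k choose (k div 2)) * inf_norm A ^ k * max_coeff k B)"
  proof (rule sum_bounded_above)
    fix i assume i: "i \<in> {0..k}"
    have "spec_norm (smat (coeff (q i) j) (B i)) \<le> norm (coeff (q i) j) * spec_norm (B i)"
      by (rule spec_norm_smat_le)
    also have "\<dots> \<le> real (k choose (k div 2)) * inf_norm A ^ k * max_coeff k B"
      using i by (intro mult_mono q_le spec_norm_le_max_coeff) (auto simp: inf_norm_nonneg)
    finally show "spec_norm (smat (coeff (q i) j) (B i)) \<le>
        real (k choose (k div 2)) * inf_norm A ^ k * max_coeff k B" .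
  qed
  finally show "spec_norm (Bt j) \<le>
      (real k + 1) * real (k choose (k div 2)) * inf_norm A ^ k * max_coeff k B"
    by (simp add: mult.assoc add.commute)
qed

lemma max_coeff_pos_if_regular:
  fixes B :: "nat \<Rightarrow> complex^'n^'n"
  assumes "regular_hpoly k B"
  shows "0 < max_coeff k B"
proof (rule ccontr)
  assume "\<not> 0 < max_coeff k B"
  then have "spec_norm (B i) = 0" if "i \<le> k" for i
    using spec_norm_le_max_coeff [OF that, of B] spec_norm_nonneg [of "B i"] by linarith
  then have "hpoly k B \<alpha> \<beta> = 0" for \<alpha> \<beta>
    by (simp add: hpoly_def smat_def vec_eq_iff)
  moreover have "det (0 :: complex^'n^'n) = 0"
    by (rule det_zero_row(1)) (simp add: row_def zero_vec_def)
  ultimately show False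
    using assms by (simp add: regular_hpoly_def)
qed

lemma matrix_inv_mult_vec_cancel:
  fixes A :: "complex^'n^'n"
  assumes "invertible A"
  shows "matrix_inv A *v (A *v u) = u" and "A *v (matrix_inv A *v u) = u"
proof -
  have "A ** matrix_inv A = mat 1 \<and> matrix_inv A ** A = mat 1"
    using assms unfolding invertible_def matrix_inv_def by (rule someI_ex)
  then show "matrix_inv A *v (A *v u) = u" and "A *v (matrix_inv A *v u) = u"
    by (simp_all add: matrix_vector_mul_assoc)
qed

subsection \<open>Quotients of backward errors\<close>

text \<open>Each estimate of the ratio uses \<open>wsum_le\<close> for one sum and
  \<open>wsum_ge\<close> for the other, hence a single factor \<open>k + 1\<close>. The maximum
  norms at \<open>v\<close> and \<open>A *v v\<close> are compared through \<open>A\<close> for the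
  lower bound and through its inverse for the upper one.\<close>

lemma wsum_ratio_bounds:
  fixes A :: "complex^2^2"
  assumes A: "invertible A" and v: "v \<noteq> 0"
    and m: "0 < m" "m \<le> \<omega> 0" "m \<le> \<omega> k" and W: "\<And>i. i \<le> k \<Longrightarrow> 0 \<le> \<omega> i \<and> \<omega> i \<le> W"
    and m': "0 < m'" "m' \<le> \<omega>' 0" "m' \<le> \<omega>' k" and W': "\<And>i. i \<le> k \<Longrightarrow> 0 \<le> \<omega>' i \<and> \<omega>' i \<le> W'"
  shows "0 < wsum \<omega> k (A *v v)" and "0 < wsum \<omega>' k v"
    and "m' / (W * ((real k + 1) * inf_norm A ^ k)) \<le> wsum \<omega>' k v / wsum \<omega> k (A *v v)"
    and "wsum \<omega>' k v / wsum \<omega> k (A *v v) \<le> W' / m * ((real k + 1) * inf_norm (matrix_inv A) ^ k)"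
proof -
  let ?u = "A *v v"
  have u: "?u \<noteq> 0"
    using v matrix_inv_mult_vec_cancel(1) [OF A, of v] by force
  have W0: "0 < W" "0 < W'"
    using m W [of 0] m' W' [of 0] by auto
  have wu: "m * max_norm2 ?u ^ k \<le> wsum \<omega> k ?u" "wsum \<omega> k ?u \<le> (real k + 1) * W * max_norm2 ?u ^ k"
    using m W W0 by (auto intro!: wsum_ge wsum_le)
  have wv: "m' * max_norm2 v ^ k \<le> wsum \<omega>' k v" "wsum \<omega>' k v \<le> (real k + 1) * W' * max_norm2 v ^ k"
    using m' W' W0 by (auto intro!: wsum_ge wsum_le)
  have pos: "0 < m * max_norm2 ?u ^ k" "0 < m' * max_norm2 v ^ k"
    using m m' max_norm2_pos [OF u] max_norm2_pos [OF v] by auto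
  show wsum_pos: "0 < wsum \<omega> k ?u" "0 < wsum \<omega>' k v"
    using wu wv pos by linarith+
  have "max_norm2 ?u ^ k \<le> (inf_norm A * max_norm2 v) ^ k"
    using max_norm2_pos [OF u] by (intro power_mono max_norm2_matrix_vector_le) simp
  then have uv: "max_norm2 ?u ^ k \<le> inf_norm A ^ k * max_norm2 v ^ k"
    by (simp add: power_mult_distrib)
  have "max_norm2 v \<le> inf_norm (matrix_inv A) * max_norm2 ?u"
    using max_norm2_matrix_vector_le [of "matrix_inv A" ?u] matrix_inv_mult_vec_cancel(1) [OF A] by simp
  then have "max_norm2 v ^ k \<le> (inf_norm (matrix_inv A) * max_norm2 ?u) ^ k"
    using max_norm2_pos [OF v] by (intro power_mono) simp_all
  then have vu: "max_norm2 v ^ k \<le> inf_norm (matrix_inv A) ^ k * max_norm2 ?u ^ k"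
    by (simp add: power_mult_distrib)
  have "wsum \<omega> k ?u \<le> (real k + 1) * W * (inf_norm A ^ k * max_norm2 v ^ k)"
    using wu(2) uv W0 by (auto elim!: order_trans intro!: mult_left_mono)
  then have up: "wsum \<omega> k ?u \<le> W * ((real k + 1) * inf_norm A ^ k) * max_norm2 v ^ k"
    by (simp add: mult_ac)
  \<comment> \<open>Positivity of the power of \<open>inf_norm A\<close> is read off from
    \<open>up\<close>, whose left side is positive.\<close>
  with wsum_pos max_norm2_pos [OF v] have den: "0 < W * ((real k + 1) * inf_norm A ^ k)"
    by (auto intro: zero_less_mult_pos2 [OF less_le_trans])
  have "m' * wsum \<omega> k ?u \<le> m' * (W * ((real k + 1) * inf_norm A ^ k) * max_norm2 v ^ k)"
    using up m'(1) by (intro mult_left_mono) auto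
  also have "\<dots> = W * ((real k + 1) * inf_norm A ^ k) * (m' * max_norm2 v ^ k)"
    by (simp add: mult_ac)
  also have "\<dots> \<le> W * ((real k + 1) * inf_norm A ^ k) * wsum \<omega>' k v"
    using wv(1) den by (intro mult_left_mono) auto
  finally show "m' / (W * ((real k + 1) * inf_norm A ^ k)) \<le> wsum \<omega>' k v / wsum \<omega> k ?u"
    using den wsum_pos by (simp add: frac_le_eq divide_le_eq le_divide_eq mult.commute)
  let ?c = "(real k + 1) * inf_norm (matrix_inv A) ^ k"
  have c: "0 \<le> ?c"
    by (simp add: inf_norm_nonneg)
  have "wsum \<omega>' k v \<le> (real k + 1) * W' * (inf_norm (matrix_inv A) ^ k * max_norm2 ?u ^ k)"
    using wv(2) vu W0 by (auto elim!: order_trans intro!: mult_left_mono)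
  also have "\<dots> = W' / m * ?c * (m * max_norm2 ?u ^ k)"
    using m(1) by simp
  also have "\<dots> \<le> W' / m * ?c * wsum \<omega> k ?u"
    using wu(1) W0 m(1) c by (intro mult_left_mono) auto
  finally show "wsum \<omega>' k v / wsum \<omega> k ?u \<le> W' / m * ?c"
    using wsum_pos by (simp add: divide_le_eq)
qed

lemma quotients_betweenI:
  fixes A :: "complex^2^2" and B Bt :: "nat \<Rightarrow> complex^'n^'n"
  assumes A: "invertible A"
    and moebius: "\<And>w. hpoly k Bt (w$1) (w$2) = hpoly k B ((A *v w)$1) ((A *v w)$2)"
    and nz: "x \<noteq> 0" "y \<noteq> 0" "v \<noteq> 0"
    and m: "0 < m" "m \<le> W k B 0" "m \<le> W k B k"
    and M: "\<And>i. i \<le> k \<Longrightarrow> 0 \<le> W k B i \<and> W k B i \<le> M"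
    and m': "0 < m'" "m' \<le> W k Bt 0" "m' \<le> W k Bt k"
    and M': "\<And>i. i \<le> k \<Longrightarrow> 0 \<le> W k Bt i \<and> W k Bt i \<le> M'"
    and lo: "lo \<le> m' / (M * ((real k + 1) * inf_norm A ^ k))"
    and hi: "M' / m * ((real k + 1) * inf_norm (matrix_inv A) ^ k) \<le> hi"
  shows "quotients_between lo hi W k B Bt A x y v"
proof -
  let ?R = "wsum (W k Bt) k v / wsum (W k B) k (A *v v)"
  note bounds = wsum_ratio_bounds [where \<omega> = "W k B" and \<omega>' = "W k Bt" and m = m and m' = m' and W = M
      and W' = M', OF A nz(3) m M m' M']
  have u: "A *v v \<noteq> 0"
    using nz(3) matrix_inv_mult_vec_cancel(1) [OF A, of v] by force
  have R: "lo \<le> ?R" "?R \<le> hi"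
    using bounds(3,4) lo hi by linarith+
  \<comment> \<open>A nonzero denominator means a nonzero residual. By \<open>moebius\<close> the
    numerator has the same residual, so it cancels together with \<open>norm x\<close>, leaving a
    ratio independent of the vector.\<close>
  have r: "eta_right (W k Bt) k Bt x (line v) \<noteq> 0 \<Longrightarrow> Q_right W k B Bt A x v = ?R"
    using nz u M M' bounds(1,2) by (auto simp: Q_right_def eta_right_eq moebius)
  have l: "eta_left (W k Bt) k Bt y (line v) \<noteq> 0 \<Longrightarrow> Q_left W k B Bt A y v = ?R"
    using nz u M M' bounds(1,2) by (auto simp: Q_left_def eta_left_eq moebius)
  show ?thesis
    unfolding quotients_between_def using R r l by auto
qed

theorem theorem6p2:
  fixes k :: nat
    and B Bt :: "nat \<Rightarrow> complex^'n^'n"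
    and A :: "complex^2^2"
    and x y :: "complex^'n"
    and v :: "complex^2"
  assumes "regular_hpoly k B"
    and "invertible A"
    and "\<And>\<gamma> \<delta>. moebius_transform A k B \<gamma> \<delta> = hpoly k Bt \<gamma> \<delta>"
    and "x \<noteq> 0" and "y \<noteq> 0" and "v \<noteq> 0"
  shows "quotients_between
           (1 / ((real k + 1) * inf_norm A ^ k))
           ((real k + 1) * inf_norm (matrix_inv A) ^ k)
           weight_a k B Bt A x y v \<and>
         quotients_between
           (1 / (Y_const k * cond_inf A ^ k))
           (Y_const k * cond_inf A ^ k)
           weight_p k B Bt A x y v \<and>
         (B 0 \<noteq> 0 \<and> B k \<noteq> 0 \<and> Bt 0 \<noteq> 0 \<and> Bt k \<noteq> 0 \<longrightarrow>
          quotients_between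
           (1 / (Y_const k * cond_inf A ^ k * coeff_ratio k Bt))
           (Y_const k * cond_inf A ^ k * coeff_ratio k B)
           weight_r k B Bt A x y v)"
proof -
  let ?a = "(real k + 1) * inf_norm A ^ k" and ?i = "(real k + 1) * inf_norm (matrix_inv A) ^ k"
  let ?c = "real (k choose (k div 2))"
  let ?b = "max_coeff k B" and ?bt = "max_coeff k Bt"
  note A = \<open>invertible A\<close>
  have moebius: "hpoly k Bt (w$1) (w$2) = hpoly k B ((A *v w)$1) ((A *v w)$2)" for w
    using assms(3) [of "w$1" "w$2"]
    by (simp add: moebius_transform_def hpoly_def matrix_vector_mult_def sum_2)
  have moebius_inv: "hpoly k B (w$1) (w$2) =
      hpoly k Bt ((matrix_inv A *v w)$1) ((matrix_inv A *v w)$2)" for w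
    by (simp add: moebius matrix_inv_mult_vec_cancel [OF A])
  have b: "0 < ?b"
    by (rule max_coeff_pos_if_regular) fact
  have bt_le: "?bt \<le> ?c * ?a * ?b"
    using max_coeff_moebius_le [OF moebius] by (simp add: mult_ac)
  have b_le: "?b \<le> ?c * ?i * ?bt"
    using max_coeff_moebius_le [OF moebius_inv] by (simp add: mult_ac)
  have a: "0 \<le> ?a" and i: "0 \<le> ?i"
    by (simp_all add: inf_norm_nonneg)
  \<comment> \<open>If all coefficients of the transform vanished, transforming back would make
    those of the regular polynomial vanish too.\<close>
  have bt: "0 < ?bt"
    using b b_le max_coeff_nonneg [of k Bt] by (cases "?bt = 0") auto
  have a': "0 < ?a"
    using a bt bt_le by (metis less_le mult_zero_left mult_zero_right not_le)
  \<comment> \<open>The square of \<open>k + 1\<close> comes from one factor in \<open>?a\<close>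
    and one in \<open>?i\<close>; the binomial comes from comparing coefficients.\<close>
  have Y: "Y_const k * cond_inf A ^ k = ?c * ?a * ?i"
    by (simp add: Y_const_def cond_inf_def power_mult_distrib power2_eq_square mult_ac)
  \<comment> \<open>Here \<open>m\<close> is left open: \<open>m = ?b\<close> makes the last factor
    1 for the weights p, while the smaller extreme coefficient norm makes it
    \<open>coeff_ratio k B\<close> for the weights r. The bound \<open>lb\<close> is used likewise
    for the transform.\<close>
  have ub: "?bt / m * ?i \<le> ?c * ?a * ?i * (?b / m)" if "0 < m" for m
  proof -
    have "?bt / m * ?i \<le> ?c * ?a * ?b / m * ?i"
      using bt_le that i by (intro mult_right_mono divide_right_mono) auto
    then show ?thesis
      by (simp add: mult_ac)
  qed
  have lb: "1 / (?c * ?a * ?i * (?bt / m)) \<le> m / (?b * ?a)" if "0 < m" for m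
  proof -
    have "1 / (?c * ?a * ?i * (?bt / m)) = m / (?c * ?i * ?bt * ?a)"
      by (simp add: mult_ac)
    also have "\<dots> \<le> m / (?b * ?a)"
    proof (rule divide_left_mono)
      show le: "?b * ?a \<le> ?c * ?i * ?bt * ?a"
        using b_le a by (rule mult_right_mono)
      have ba: "0 < ?b * ?a"
        using b a' by (rule mult_pos_pos)
      from less_le_trans [OF ba le] ba show "0 < ?c * ?i * ?bt * ?a * (?b * ?a)"
        by (rule mult_pos_pos)
    qed (use that in simp)
    finally show ?thesis .
  qed
  have "quotients_between (1 / ?a) ?i weight_a k B Bt A x y v"
    by (rule quotients_betweenI [OF A moebius assms(4-6), where m = 1 and m' = 1 and M = 1 and M' = 1])
      (simp_all add: weight_a_def)
  moreover have "quotients_between (1 / (Y_const k * cond_inf A ^ k)) (Y_const k * cond_inf A ^ k)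
      weight_p k B Bt A x y v"
    using b bt ub [OF b] lb [OF bt]
    by - (rule quotients_betweenI
        [OF A moebius assms(4-6), where m = ?b and m' = ?bt and M = ?b and M' = ?bt],
      simp_all add: weight_p_def Y)
  moreover have "quotients_between (1 / (Y_const k * cond_inf A ^ k * coeff_ratio k Bt))
      (Y_const k * cond_inf A ^ k * coeff_ratio k B) weight_r k B Bt A x y v"
    if "B 0 \<noteq> 0" "B k \<noteq> 0" "Bt 0 \<noteq> 0" "Bt k \<noteq> 0"
  proof -
    let ?m = "min (spec_norm (B 0)) (spec_norm (B k))"
    let ?mt = "min (spec_norm (Bt 0)) (spec_norm (Bt k))"
    have pos: "0 < ?m" "0 < ?mt"
      using that by (simp_all add: spec_norm_pos_iff)
    show ?thesis
      unfolding Y coeff_ratio_def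
      by (rule quotients_betweenI
          [OF A moebius assms(4-6), where m = ?m and m' = ?mt and M = ?b and M' = ?bt])
        (use pos ub [OF pos(1)] lb [OF pos(2)] in \<open>simp_all add: weight_r_def spec_norm_le_max_coeff\<close>)
  qed
  ultimately show ?thesis
    by blast
qed

end
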